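(* Let $\nu$ be a positive integer. For every even integer $r$ with $2\nu\le r\le 2\nu+12\lfloor\nu/3\rfloor$ there exists a strongly regular graph with parameters $(2^{2\nu}-1,\,2^{2\nu-1},\,2^{2\nu-2},\,2^{2\nu-2})$ whose adjacency matrix has 2-rank $r$.
   Context: A strongly regular graph with parameters $(v,k,\lambda,\mu)$ is a $k$-regular graph on $v$ vertices in which any two adjacent vertices have exactly $\lambda$ common neighbours and any two distinct nonadjacent vertices have exactly $\mu$ common neighbours. The 2-rank of the adjacency matrix is its rank over $\mathbb{F}_2$. *)

theory Defs
  imports
    "Graph_Theory.Pair_Digraph"
    "Jordan_Normal_Form.DL_Rank"
    "HOL-Library.Z2"
begin

text \<open>
  A \<^locale>\<open>pair_graph\<close> is a finite simple graph: its set of arcs is a symmetric irreflexive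
  relation on the vertex set, so each edge is represented by its two orientations and
  \<^const>\<open>out_degree\<close> is the usual degree. Complete graphs and empty graphs are not excluded;
  for them the condition on nonadjacent, respectively adjacent, vertices is vacuous.
\<close>

locale strongly_regular_graph = pair_graph G
  for G :: "'a pair_pre_digraph" +
  fixes v k l m :: nat
  assumes card_verts: "card (pverts G) = v"
    and regular: "x \<in> pverts G \<Longrightarrow> out_degree (with_proj G) x = k"
    and adjacent: "\<lbrakk>x \<in> pverts G; y \<in> pverts G; (x, y) \<in> parcs G\<rbrakk>
      \<Longrightarrow> card {z \<in> pverts G. (x, z) \<in> parcs G \<and> (y, z) \<in> parcs G} = l"
    and nonadjacent: "\<lbrakk>x \<in> pverts G; y \<in> pverts G; x \<noteq> y; (x, y) \<notin> parcs G\<rbrakk>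
      \<Longrightarrow> card {z \<in> pverts G. (x, z) \<in> parcs G \<and> (y, z) \<in> parcs G} = m"

text \<open>
  Rows and columns are indexed by the vertices in increasing order; another order would
  conjugate the matrix by a permutation matrix, which does not affect its rank.
\<close>

definition adjacency_matrix :: "'a::linorder pair_pre_digraph \<Rightarrow> 'b::zero_neq_one mat" where
  "adjacency_matrix G =
     (let xs = sorted_list_of_set (pverts G); n = card (pverts G)
      in mat n n (\<lambda>(i, j). if (xs ! i, xs ! j) \<in> parcs G then 1 else 0))"

text \<open>The type \<^typ>\<open>bit\<close> is the field with two elements.\<close>

definition two_rank :: "'a::linorder pair_pre_digraph \<Rightarrow> nat" where
  "two_rank G = vec_space.rank (card (pverts G)) (adjacency_matrix G :: bit mat)"

end

theory Submission
  imports Defs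
begin

text \<open>
  If \<open>f\<close> is a symmetric form over the field with two elements on an \<open>N\<close>-point set, with zero
  diagonal and a zero row, and the signs \<open>(-1)^f\<close> form a Hadamard matrix, then deleting the point
  of the zero row leaves the adjacency matrix of a strongly regular graph with parameters
  \<open>(N - 1, N/2, N/4, N/4)\<close>. Tensor products of Hadamard matrices add the forms, and the
  2-ranks add up because the zero rows keep the two column spaces independent. So it suffices
  to realise rank 2 for \<open>N = 4\<close> (the triangle) and ranks 6, 8, ..., 18 for \<open>N = 64\<close>.
  For the latter start with the symplectic form of rank 6 and apply Godsil--McKay switching with
  respect to up to six disjoint quadruples that do not disturb each other. Switching adds
  \<open>d s\<^sup>T + s d\<^sup>T\<close>, where \<open>d\<close> is the indicator of the quadruple and \<open>s\<close> that of the points with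
  exactly two neighbours in it; the rank grows by 2 at each step since the six coordinate functions
  and all the \<open>d\<close> and \<open>s\<close> are linearly independent.
\<close>

section \<open>Hadamard matrices as forms over the field with two elements\<close>

definition signed :: "bit \<Rightarrow> int" where
  "signed b = (if b = 0 then 1 else - 1)"

lemma signed_simps [simp]: "signed 0 = 1" "signed 1 = - 1"
  by (simp_all add: signed_def)

lemma signed_add: "signed (a + b) = signed a * signed b"
  by (cases a; cases b) simp_all

lemma signed_mult_self [simp]: "signed a * signed a = 1"
  by (cases a) simp_all

text \<open>Row norms are \<open>N\<close> automatically, since all entries are signs.\<close>

definition hadamard :: "nat \<Rightarrow> (nat \<Rightarrow> nat \<Rightarrow> bit) \<Rightarrow> bool" where
  "hadamard N f \<longleftrightarrow>
    (\<forall>i<N. \<forall>j<N. i \<noteq> j \<longrightarrow> (\<Sum>z<N. signed (f i z) * signed (f j z)) = 0)"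

lemma sum_div_mod:
  fixes g :: "nat \<Rightarrow> nat \<Rightarrow> 'a::comm_monoid_add"
  shows "(\<Sum>z<M * N. g (z div N) (z mod N)) = (\<Sum>x<M. \<Sum>y<N. g x y)"
proof -
  have "(\<Sum>x<M. \<Sum>y<N. g x y) = (\<Sum>(x, y)\<in>{..<M} \<times> {..<N}. g x y)"
    by (simp add: sum.cartesian_product)
  also have "\<dots> = (\<Sum>z<M * N. g (z div N) (z mod N))"
  proof (rule sum.reindex_bij_witness[where i = "\<lambda>z. (z div N, z mod N)" and j = "\<lambda>(x, y). x * N + y"])
    fix a assume "a \<in> {..<M} \<times> {..<N}"
    then obtain x y where a: "a = (x, y)" "x < M" "y < N" by auto
    have "x * N + y < Suc x * N" using a by simp
    also have "\<dots> \<le> M * N" using a by (intro mult_right_mono) auto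
    finally show "(case a of (x, y) \<Rightarrow> x * N + y) \<in> {..<M * N}" by (simp add: a)
  next
    fix z assume z: "z \<in> {..<M * N}"
    then have "0 < N" by (cases N) auto
    with z show "(z div N, z mod N) \<in> {..<M} \<times> {..<N}"
      by (auto simp: less_mult_imp_div_less)
  qed auto
  finally show ?thesis ..
qed

text \<open>The exponent of a Kronecker product of sign matrices: multiplying signs adds
  exponents.\<close>

definition tensor :: "nat \<Rightarrow> (nat \<Rightarrow> nat \<Rightarrow> bit) \<Rightarrow> (nat \<Rightarrow> nat \<Rightarrow> bit) \<Rightarrow> nat \<Rightarrow> nat \<Rightarrow> bit" where
  "tensor N f g x y = f (x div N) (y div N) + g (x mod N) (y mod N)"

text \<open>The inner product of two rows factors over the blocks, and distinct indices differ in
  quotient or remainder, so one factor is zero.\<close>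

lemma hadamard_tensor:
  assumes f: "hadamard M f" and g: "hadamard N g"
  shows "hadamard (M * N) (tensor N f g)"
  unfolding hadamard_def
proof (intro allI impI)
  fix i j assume ij: "i < M * N" "j < M * N" "i \<noteq> j"
  then have "0 < N" by (cases N) auto
  have "(\<Sum>z<M * N. signed (tensor N f g i z) * signed (tensor N f g j z))
    = (\<Sum>x<M. \<Sum>y<N. (signed (f (i div N) x) * signed (f (j div N) x)) *
        (signed (g (i mod N) y) * signed (g (j mod N) y)))"
    unfolding sum_div_mod[symmetric] tensor_def signed_add by (simp add: ac_simps)
  also have "\<dots> = (\<Sum>x<M. signed (f (i div N) x) * signed (f (j div N) x)) *
        (\<Sum>y<N. signed (g (i mod N) y) * signed (g (j mod N) y))"
    by (simp add: sum_product)
  also have "\<dots> = 0"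
  proof (cases "i div N = j div N")
    case True
    then have "i mod N \<noteq> j mod N" using ij by (metis div_mult_mod_eq)
    then show ?thesis using g \<open>0 < N\<close> unfolding hadamard_def by simp
  next
    case False
    then show ?thesis using f ij unfolding hadamard_def
      by (simp add: less_mult_imp_div_less)
  qed
  finally show "(\<Sum>z<M * N. signed (tensor N f g i z) * signed (tensor N f g j z)) = 0" .
qed

section \<open>Alternating forms and the symplectic Hadamard matrix\<close>

definition alt_form :: "nat \<Rightarrow> (nat \<Rightarrow> nat \<Rightarrow> bit) \<Rightarrow> nat \<Rightarrow> nat \<Rightarrow> bit" where
  "alt_form n \<phi> x y = (\<Sum>i<n. \<phi> (2 * i) x * \<phi> (2 * i + 1) y + \<phi> (2 * i + 1) x * \<phi> (2 * i) y)"

lemma alt_form_sym: "alt_form n \<phi> x y = alt_form n \<phi> y x"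
  unfolding alt_form_def by (intro sum.cong refl) (simp only: ac_simps)

lemma bit_add_self [simp]: "(b :: bit) + b = 0"
  by (cases b) simp_all

lemma alt_form_self [simp]: "alt_form n \<phi> x x = 0"
  unfolding alt_form_def by (intro sum.neutral ballI) (simp only: mult.commute bit_add_self)

text \<open>Points are vectors over F_2 written in binary, with \<open>xor\<close> as addition;
  \<open>alt_form m coord\<close> is then the standard symplectic form on F_2^(2m).\<close>

definition coord :: "nat \<Rightarrow> nat \<Rightarrow> bit" where
  "coord a x = of_bool (bit x a)"

lemma coord_xor: "coord a (Bit_Operations.xor x y) = coord a x + coord a y"
  by (simp add: coord_def bit_xor_iff of_bool_def)

lemma symplectic_xor:
  "alt_form m coord x (Bit_Operations.xor y z) = alt_form m coord x y + alt_form m coord x z"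
  unfolding alt_form_def sum.distrib[symmetric] coord_xor
  by (intro sum.cong refl) (simp only: algebra_simps)

lemma symplectic_unit:
  assumes "i < m"
  shows "alt_form m coord x (2 ^ (2 * i)) = coord (2 * i + 1) x"
    and "alt_form m coord x (2 ^ (2 * i + 1)) = coord (2 * i) x"
proof -
  have eq: "2 * a = 2 * b \<longleftrightarrow> a = b" "2 * a \<noteq> Suc (2 * b)" "Suc (2 * a) \<noteq> 2 * b" for a b :: nat
    by presburger+
  have "alt_form m coord x (2 ^ (2 * i)) = (\<Sum>a<m. if a = i then coord (2 * i + 1) x else 0)"
    unfolding alt_form_def coord_def bit_exp_iff
    by (intro sum.cong refl) (auto simp: eq possible_bit_def simp del: power_Suc)
  moreover have "alt_form m coord x (2 ^ (2 * i + 1)) = (\<Sum>a<m. if a = i then coord (2 * i) x else 0)"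
    unfolding alt_form_def coord_def bit_exp_iff
    by (intro sum.cong refl) (auto simp: eq possible_bit_def simp del: power_Suc)
  ultimately show "alt_form m coord x (2 ^ (2 * i)) = coord (2 * i + 1) x"
    "alt_form m coord x (2 ^ (2 * i + 1)) = coord (2 * i) x"
    using assms by (simp_all only: sum.delta finite_lessThan lessThan_iff if_True)
qed

text \<open>Translation by a vector \<open>2 ^ c\<close> whose pairing reads a digit in which
  \<open>x\<close> and \<open>y\<close> differ flips the sign of every term, so the sum equals its
  own negative.\<close>

lemma hadamard_symplectic: "hadamard (2 ^ (2 * m)) (alt_form m coord)"
  unfolding hadamard_def
proof (intro allI impI)
  fix x y :: nat assume xy: "x < 2 ^ (2 * m)" "y < 2 ^ (2 * m)" "x \<noteq> y"
  let ?g = "\<lambda>z. signed (alt_form m coord x z) * signed (alt_form m coord y z)"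
  have "take_bit (2 * m) x = x" "take_bit (2 * m) y = y"
    using xy by (simp_all add: take_bit_nat_eq_self)
  then obtain b where b: "b < 2 * m" "bit x b \<noteq> bit y b"
    using xy(3) by (metis bit_eq_iff bit_take_bit_iff)
  \<comment> \<open>\<open>c\<close> is the hyperbolic partner of \<open>b\<close>:
    \<open>b + 1\<close> for even \<open>b\<close>, \<open>b - 1\<close> for odd
    \<open>b\<close>.\<close>
  have "\<exists>c<2 * m. \<forall>w. alt_form m coord w (2 ^ c) = coord b w"
  proof (cases "even b")
    case True
    then obtain i where "b = 2 * i" by blast
    then show ?thesis using b symplectic_unit(2)[of i m]
      by (intro exI[of _ "2 * i + 1"]) auto
  next
    case False
    then obtain i where "b = 2 * i + 1" by (elim oddE)
    then show ?thesis using b symplectic_unit(1)[of i m]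
      by (intro exI[of _ "2 * i"]) auto
  qed
  then obtain c where c: "c < 2 * m" "\<And>w. alt_form m coord w (2 ^ c) = coord b w" by blast
  have lt: "Bit_Operations.xor z (2 ^ c) < 2 ^ (2 * m)" if "z < 2 ^ (2 * m)" for z :: nat
  proof -
    have "take_bit (2 * m) (Bit_Operations.xor z (2 ^ c)) = Bit_Operations.xor z (2 ^ c)"
      using that c(1) by (simp add: take_bit_xor take_bit_nat_eq_self)
    then show ?thesis by (metis take_bit_nat_less_exp)
  qed
  have "(\<Sum>z<2 ^ (2 * m). ?g z) = (\<Sum>z<2 ^ (2 * m). ?g (Bit_Operations.xor z (2 ^ c)))"
    by (rule sum.reindex_bij_witness[where i = "\<lambda>z. Bit_Operations.xor z (2 ^ c)"
          and j = "\<lambda>z. Bit_Operations.xor z (2 ^ c)"]) (auto simp: lt xor.assoc)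
  also have "\<dots> = - (\<Sum>z<2 ^ (2 * m). ?g z)"
    using b(2) unfolding sum_negf[symmetric]
    by (intro sum.cong) (auto simp: symplectic_xor c(2) signed_add coord_def)
  finally show "(\<Sum>z<2 ^ (2 * m). ?g z) = 0" by simp
qed

section \<open>Godsil--McKay switching\<close>

definition switch :: "nat set \<Rightarrow> (nat \<Rightarrow> bit) \<Rightarrow> (nat \<Rightarrow> nat \<Rightarrow> bit) \<Rightarrow> nat \<Rightarrow> nat \<Rightarrow> bit" where
  "switch D s f x y = f x y + (of_bool (x \<in> D) * s y + s x * of_bool (y \<in> D))"

text \<open>For a quadruple in which \<open>x\<close> has an even number of neighbours, the value 1 means exactly two.\<close>

definition splits :: "(nat \<Rightarrow> nat \<Rightarrow> bit) \<Rightarrow> nat set \<Rightarrow> nat \<Rightarrow> bit" where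
  "splits f D x = of_bool (\<exists>y\<in>D. \<exists>z\<in>D. f x y \<noteq> f x z)"

text \<open>The number of ones among the four values is 0, 2 or 4: with 2 the signs cancel,
  otherwise all equal the sign at \<open>y\<close>.\<close>

lemma sum_signed_even:
  assumes "card D = 4" and "(\<Sum>y\<in>D. f x y) = 0" and "y \<in> D"
  shows "(\<Sum>y\<in>D. signed (f x y)) = (if splits f D x = 0 then 4 * signed (f x y) else 0)"
proof -
  from assms(1) obtain a b c e where D: "D = {a, b, c, e}"
    and d: "a \<noteq> b" "a \<noteq> c" "a \<noteq> e" "b \<noteq> c" "b \<noteq> e" "c \<noteq> e"
    by (auto simp: card_Suc_eq numeral_eq_Suc)
  have sums: "(\<Sum>y\<in>D. g y) = g a + (g b + (g c + g e))" for g :: "nat \<Rightarrow> 'b::comm_monoid_add"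
    unfolding D using d by simp
  show ?thesis
    using assms(2,3) unfolding sums splits_def unfolding D
    by (cases "f x a"; cases "f x b"; cases "f x c"; cases "f x e") auto
qed

lemma hadamard_switch:
  assumes f: "hadamard N f" and sym: "\<And>x y. f x y = f y x"
    and D: "D \<subseteq> {..<N}" "card D = 4"
    and DD: "\<And>x y. x \<in> D \<Longrightarrow> y \<in> D \<Longrightarrow> f x y = 0"
    and even: "\<And>x. x < N \<Longrightarrow> (\<Sum>y\<in>D. f x y) = 0"
    and s: "\<And>x. x < N \<Longrightarrow> s x = splits f D x"
  shows "hadamard N (switch D s f)"
  \<comment> \<open>Conjugation by the orthogonal matrix \<open>Q\<close> that is \<open>J/2 - I\<close> on \<open>D\<close> and the identity elsewhere;
    \<open>g\<close> is the one-sided product with \<open>Q\<close>.\<close>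
proof -
  have fin: "finite D" using D finite_subset by blast
  obtain d where d: "d \<in> D" using D(2) by fastforce
  define h where "h x y = signed (f x y)" for x y
  define h' where "h' x y = signed (switch D s f x y)" for x y
  \<comment> \<open>\<open>t x\<close> is half the sum of row \<open>x\<close> over
    \<open>D\<close>, an integer by \<open>sum_signed_even\<close>; by \<open>t_eq\<close> any point
    of \<open>D\<close> may replace \<open>d\<close>.\<close>
  define t where "t x = (if s x = 0 then 2 * h x d else 0)" for x
  define g where "g x z = (if z \<in> D then t x - h x z else h x z)" for x z
  have t: "(\<Sum>y\<in>D. h x y) = 2 * t x" if "x < N" for x
    using sum_signed_even[of D f x d, OF D(2) even[OF that] d] s[OF that] by (simp add: h_def t_def)
  have t_eq: "t x = (if s x = 0 then 2 * h x y else 0)" if "x < N" "y \<in> D" for x y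
    using t[OF that(1)] sum_signed_even[of D f x y, OF D(2) even[OF that(1)] that(2)] s[OF that(1)]
    by (auto simp: h_def)
  have s_D: "s x = 0" if "x \<in> D" for x
    using that D s DD by (auto simp: splits_def)
  have h_D: "h x y = 1" if "x \<in> D" "y \<in> D" for x y
    using that DD by (simp add: h_def)
  have h_sym: "h x y = h y x" for x y by (simp add: h_def sym)
  \<comment> \<open>The orthogonal \<open>Q\<close> preserves inner products of rows: the correction
    is \<open>4 * t x * t y - 2 * t x * t y - 2 * t x * t y\<close>, as
    \<open>card D = 4\<close>.\<close>
  have gram: "(\<Sum>z<N. g x z * g y z) = (if x = y then int N else 0)" if xy: "x < N" "y < N" for x y
  proof -
    have "(\<Sum>z<N. g x z * g y z - h x z * h y z) = (\<Sum>z\<in>D. g x z * g y z - h x z * h y z)"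
      using D(1) by (intro sum.mono_neutral_right) (auto simp: g_def)
    also have "\<dots> = (\<Sum>z\<in>D. t x * t y - (t x * h y z + t y * h x z))"
      by (intro sum.cong) (auto simp: g_def algebra_simps)
    also have "\<dots> = 0"
      using t[OF xy(1)] t[OF xy(2)] D(2)
      by (simp add: sum_subtractf sum.distrib sum_distrib_left[symmetric])
    finally have "(\<Sum>z<N. g x z * g y z) = (\<Sum>z<N. h x z * h y z)"
      by (simp add: sum_subtractf)
    also have "\<dots> = (if x = y then int N else 0)"
      using f xy by (auto simp: hadamard_def h_def)
    finally show ?thesis .
  qed
  \<comment> \<open>Left multiplication by \<open>Q\<close> fixes these rows, so \<open>g\<close> is
    already the switched row: on \<open>D\<close>, \<open>t x - h x z\<close> is
    \<open>h x z\<close> or \<open>- h x z\<close> according to \<open>s x\<close>.\<close>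
  have out: "h' x z = g x z" if "x < N" "z < N" "x \<notin> D" for x z
    using that t_eq[of x z]
    by (cases "s x") (auto simp: h'_def g_def h_def switch_def signed_add)
  have g_D: "g x z = h x z" if "x \<in> D" for x z
  proof -
    have "x < N" using that D by auto
    then show ?thesis using that t_eq[of x z] s_D h_D by (auto simp: g_def)
  qed
  \<comment> \<open>Left multiplication by \<open>J/2 - I\<close>, doubled to stay in the
    integers.\<close>
  have ins: "2 * h' x z = (\<Sum>y\<in>D. g y z) - 2 * g x z" if "x \<in> D" "z < N" for x z
  proof -
    have "(\<Sum>y\<in>D. g y z) = (\<Sum>y\<in>D. h z y)"
      by (intro sum.cong) (auto simp: g_D h_sym)
    also have "\<dots> = 2 * t z" using t that by simp
    finally have "(\<Sum>y\<in>D. g y z) - 2 * g x z = 2 * (t z - h z x)"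
      using that by (simp add: g_D h_sym)
    moreover have "h' x z = t z - h z x"
      using that t_eq[of z x] s_D h_D
      by (cases "s z") (auto simp: h'_def h_def switch_def signed_add sym)
    ultimately show ?thesis by simp
  qed
  have DN: "x < N" if "x \<in> D" for x using that D by auto
  have mixed: "(\<Sum>z<N. h' x z * h' y z) = 0" if "x \<in> D" "y < N" "y \<notin> D" for x y
  proof -
    have "2 * (\<Sum>z<N. h' x z * h' y z) = (\<Sum>z<N. (\<Sum>w\<in>D. g w z * g y z) - 2 * (g x z * g y z))"
      unfolding sum_distrib_left using that
      by (intro sum.cong refl)
        (simp add: out ins mult.assoc[symmetric] left_diff_distrib sum_distrib_right)
    also have "\<dots> = (\<Sum>w\<in>D. \<Sum>z<N. g w z * g y z) - 2 * (\<Sum>z<N. g x z * g y z)"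
      by (simp add: sum_subtractf sum_distrib_left sum.swap[of _ D])
    also have "\<dots> = 0" using that DN by (auto simp: gram intro!: sum.neutral)
    finally show ?thesis by simp
  qed
  \<comment> \<open>By \<open>gram\<close>, the four parts of the expanded product contribute
    \<open>4 * N\<close>, \<open>- 2 * N\<close>, \<open>- 2 * N\<close> and 0.\<close>
  have both: "(\<Sum>z<N. h' x z * h' y z) = 0" if "x \<in> D" "y \<in> D" "x \<noteq> y" for x y
  proof -
    have "4 * (\<Sum>z<N. h' x z * h' y z) = (\<Sum>z<N. (2 * h' x z) * (2 * h' y z))"
      by (simp add: sum_distrib_left)
    also have "\<dots> = (\<Sum>z<N. (\<Sum>v\<in>D. \<Sum>w\<in>D. g v z * g w z) - 2 * (\<Sum>v\<in>D. g v z * g y z)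
        - 2 * (\<Sum>w\<in>D. g x z * g w z) + 4 * (g x z * g y z))"
    proof (intro sum.cong refl)
      fix z assume "z \<in> {..<N}"
      then have z: "z < N" by simp
      show "(2 * h' x z) * (2 * h' y z) = (\<Sum>v\<in>D. \<Sum>w\<in>D. g v z * g w z) - 2 * (\<Sum>v\<in>D. g v z * g y z)
        - 2 * (\<Sum>w\<in>D. g x z * g w z) + 4 * (g x z * g y z)"
        unfolding ins[OF that(1) z] ins[OF that(2) z] sum_product[symmetric]
          sum_distrib_left[symmetric] sum_distrib_right[symmetric]
        by (simp add: algebra_simps)
    qed
    also have "\<dots> = (\<Sum>v\<in>D. \<Sum>w\<in>D. \<Sum>z<N. g v z * g w z) - 2 * (\<Sum>v\<in>D. \<Sum>z<N. g v z * g y z)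
        - 2 * (\<Sum>w\<in>D. \<Sum>z<N. g x z * g w z) + 4 * (\<Sum>z<N. g x z * g y z)"
      by (simp add: sum_subtractf sum.distrib sum_distrib_left sum.swap[of _ D "{..<N}"])
    also have "\<dots> = (\<Sum>v\<in>D. \<Sum>w\<in>D. if v = w then int N else 0)
        - 2 * (\<Sum>v\<in>D. if v = y then int N else 0) - 2 * (\<Sum>w\<in>D. if x = w then int N else 0)"
      using that DN by (simp add: gram cong: sum.cong)
    also have "\<dots> = 0"
      using that fin D(2) by (simp add: sum.delta sum.delta')
    finally show ?thesis by simp
  qed
  show ?thesis
    unfolding hadamard_def h'_def[symmetric]
  proof (intro allI impI)
    fix i j assume ij: "i < N" "j < N" "i \<noteq> j"
    consider "i \<in> D" "j \<in> D" | "i \<in> D" "j \<notin> D" | "i \<notin> D" "j \<in> D" | "i \<notin> D" "j \<notin> D" by blast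
    then show "(\<Sum>z<N. h' i z * h' j z) = 0"
    proof cases
      case 1 with ij show ?thesis by (intro both)
    next
      case 2 with ij show ?thesis by (intro mixed)
    next
      case 3
      have "(\<Sum>z<N. h' i z * h' j z) = (\<Sum>z<N. h' j z * h' i z)" by (simp add: mult.commute)
      with 3 ij show ?thesis using mixed by simp
    next
      case 4
      then have "(\<Sum>z<N. h' i z * h' j z) = (\<Sum>z<N. g i z * g j z)"
        using ij out by (intro sum.cong) auto
      with gram ij show ?thesis by simp
    qed
  qed
qed

section \<open>Rank\<close>

text \<open>The right inverse makes \<open>Q\<close> onto, so \<open>P * Q\<close> and
  \<open>P\<close> have the same column space; the left inverse makes \<open>P\<close> injective, so
  its \<open>r\<close> columns are independent.\<close>

lemma (in vec_space) rank_mult_of_inverses: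
  assumes P: "P \<in> carrier_mat n r" and Q: "Q \<in> carrier_mat r nc"
    and P': "P' \<in> carrier_mat r n" and Q': "Q' \<in> carrier_mat nc r"
    and P'P: "P' * P = 1\<^sub>m r" and QQ': "Q * Q' = 1\<^sub>m r"
  shows "rank (P * Q) = r"
proof -
  have inj: "v = w" if vw: "v \<in> carrier_vec r" "w \<in> carrier_vec r" "P *\<^sub>v v = P *\<^sub>v w" for v w
  proof -
    have "v = (P' * P) *\<^sub>v v" using vw P'P by simp
    also have "\<dots> = P' *\<^sub>v (P *\<^sub>v w)" using vw P P' by simp
    also have "\<dots> = (P' * P) *\<^sub>v w" using vw P P' by simp
    finally show ?thesis using vw P'P by simp
  qed
  have "{y \<in> carrier_vec n. \<exists>x\<in>carrier_vec nc. (P * Q) *\<^sub>v x = y}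
      = {y \<in> carrier_vec n. \<exists>x\<in>carrier_vec r. P *\<^sub>v x = y}" (is "?L = ?R")
  proof
    show "?L \<subseteq> ?R"
    proof
      fix y assume "y \<in> ?L"
      then obtain x where x: "x \<in> carrier_vec nc" "(P * Q) *\<^sub>v x = y" "y \<in> carrier_vec n" by blast
      then have "P *\<^sub>v (Q *\<^sub>v x) = y" using P Q by simp
      moreover have "Q *\<^sub>v x \<in> carrier_vec r" using Q x by simp
      ultimately show "y \<in> ?R" using x by blast
    qed
    show "?R \<subseteq> ?L"
    proof
      fix y assume "y \<in> ?R"
      then obtain x where x: "x \<in> carrier_vec r" "P *\<^sub>v x = y" "y \<in> carrier_vec n" by blast
      have "(P * Q) *\<^sub>v (Q' *\<^sub>v x) = P *\<^sub>v (Q *\<^sub>v (Q' *\<^sub>v x))"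
        using P Q Q' x by (intro assoc_mult_mat_vec) auto
      also have "Q *\<^sub>v (Q' *\<^sub>v x) = (Q * Q') *\<^sub>v x"
        using Q Q' x by (intro assoc_mult_mat_vec[symmetric]) auto
      also have "\<dots> = x" using QQ' x by simp
      finally have "(P * Q) *\<^sub>v (Q' *\<^sub>v x) = y" using x by simp
      moreover have "Q' *\<^sub>v x \<in> carrier_vec nc" using Q' x by simp
      ultimately show "y \<in> ?L" using x by blast
    qed
  qed
  then have "col_space (P * Q) = col_space P"
    using col_space_eq[OF mult_carrier_mat[OF P Q]] col_space_eq[OF P] P Q by simp
  then have "rank (P * Q) = rank P"
    unfolding rank_def col_space_def by simp
  also have "\<dots> = r"
  proof (rule lin_indpt_full_rank[OF P])
    \<comment> \<open>Independence is stated for the set of columns, which would hide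
      repetitions.\<close>
    show dist: "distinct (cols P)"
      unfolding distinct_conv_nth
    proof (intro allI impI)
      fix i j assume ij: "i < length (cols P)" "j < length (cols P)" "i \<noteq> j"
      have unit: "P *\<^sub>v unit_vec r k = col P k" if "k < r" for k
        using that P by (intro eq_vecI) auto
      show "cols P ! i \<noteq> cols P ! j"
      proof
        assume "cols P ! i = cols P ! j"
        then have "P *\<^sub>v unit_vec r i = P *\<^sub>v unit_vec r j"
          using ij P by (simp add: unit)
        then have "unit_vec r i = (unit_vec r j :: 'a vec)"
          by (rule inj[rotated 2]) auto
        then show False using ij P by simp
      qed
    qed
    show "lin_indpt (set (cols P))"
    proof
      assume "lin_dep (set (cols P))"
      then obtain v where v: "v \<in> carrier_vec r" "v \<noteq> 0\<^sub>v r" "P *\<^sub>v v = 0\<^sub>v n"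
        using lin_depE[OF P _ dist] by blast
      have "P *\<^sub>v 0\<^sub>v r = 0\<^sub>v n" using P by auto
      with v have "P *\<^sub>v v = P *\<^sub>v 0\<^sub>v r" by simp
      then have "v = 0\<^sub>v r" using v(1) by (rule inj[rotated 2]) auto
      with v(2) show False by simp
    qed
  qed
  finally show ?thesis .
qed

text \<open>The biorthogonal system \<open>\<psi>\<close> certifies independence of the
  \<open>\<phi> a\<close> in a form that finite evaluation can check.\<close>

definition dual :: "nat \<Rightarrow> nat \<Rightarrow> (nat \<Rightarrow> nat \<Rightarrow> bit) \<Rightarrow> (nat \<Rightarrow> nat \<Rightarrow> bit) \<Rightarrow> bool" where
  "dual N r \<psi> \<phi> \<longleftrightarrow> (\<forall>a<r. \<phi> a 0 = 0) \<and>
    (\<forall>a<r. \<forall>b<r. (\<Sum>x<N. \<psi> a x * \<phi> b x) = of_bool (a = b))"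

text \<open>
  A full-rank factorization with one-sided inverses of both factors. The factors vanish at 0,
  so that row 0 and column 0 can be deleted without changing the rank.
\<close>

definition has_rank :: "nat \<Rightarrow> nat \<Rightarrow> (nat \<Rightarrow> nat \<Rightarrow> bit) \<Rightarrow> bool" where
  "has_rank N r f \<longleftrightarrow> (\<exists>p q p' q'. dual N r p' p \<and> dual N r q' q \<and>
    (\<forall>x<N. \<forall>y<N. f x y = (\<Sum>a<r. p a x * q a y)))"

text \<open>Point 0 contributes nothing to the sums in \<open>dual\<close>, since the factors vanish
  there; so the one-sided inverses survive its deletion.\<close>

lemma rank_mat_bit:
  assumes "has_rank (Suc n) r f"
  shows "vec_space.rank n (mat n n (\<lambda>(i, j). f (Suc i) (Suc j))) = r"
proof -
  obtain p q p' q' where p: "dual (Suc n) r p' p" and q: "dual (Suc n) r q' q"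
    and f: "\<And>x y. x < Suc n \<Longrightarrow> y < Suc n \<Longrightarrow> f x y = (\<Sum>a<r. p a x * q a y)"
    using assms unfolding has_rank_def by blast
  define P where "P = mat n r (\<lambda>(i, a). p a (Suc i))"
  define P' where "P' = mat r n (\<lambda>(a, i). p' a (Suc i))"
  define Q where "Q = mat r n (\<lambda>(a, i). q a (Suc i))"
  define Q' where "Q' = mat n r (\<lambda>(i, a). q' a (Suc i))"
  have sums: "(\<Sum>i<n. \<psi> a (Suc i) * \<phi> b (Suc i)) = of_bool (a = b)"
    if "dual (Suc n) r \<psi> \<phi>" "a < r" "b < r" for \<psi> \<phi> a b
  proof -
    have "(\<Sum>x<Suc n. \<psi> a x * \<phi> b x) = of_bool (a = b)" "\<phi> b 0 = 0"
      using that unfolding dual_def by blast+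
    then show ?thesis unfolding sum.lessThan_Suc_shift by (simp only: mult_zero_right add_0_left)
  qed
  have "P' * P = 1\<^sub>m r"
  proof (rule eq_matI)
    fix a b assume "a < dim_row (1\<^sub>m r :: bit mat)" "b < dim_col (1\<^sub>m r :: bit mat)"
    then have ab: "a < r" "b < r" by simp_all
    then have "(P' * P) $$ (a, b) = (\<Sum>i<n. p' a (Suc i) * p b (Suc i))"
      unfolding P_def P'_def by (auto simp: scalar_prod_def lessThan_atLeast0 intro!: sum.cong)
    then show "(P' * P) $$ (a, b) = 1\<^sub>m r $$ (a, b)" using sums[OF p ab] ab by simp
  qed (auto simp: P_def P'_def)
  moreover have "Q * Q' = 1\<^sub>m r"
  proof (rule eq_matI)
    fix a b assume "a < dim_row (1\<^sub>m r :: bit mat)" "b < dim_col (1\<^sub>m r :: bit mat)"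
    then have ab: "a < r" "b < r" by simp_all
    then have "(Q * Q') $$ (a, b) = (\<Sum>i<n. q' b (Suc i) * q a (Suc i))"
      unfolding Q_def Q'_def
      by (auto simp: scalar_prod_def lessThan_atLeast0 conj_commute intro!: sum.cong)
    then show "(Q * Q') $$ (a, b) = 1\<^sub>m r $$ (a, b)" using sums[OF q ab(2,1)] ab by simp
  qed (auto simp: Q_def Q'_def)
  ultimately have "vec_space.rank n (P * Q) = r"
    by (intro vec_space.rank_mult_of_inverses[of P n r Q n P' Q'])
      (auto simp: P_def P'_def Q_def Q'_def)
  moreover have "P * Q = mat n n (\<lambda>(i, j). f (Suc i) (Suc j))"
  proof (rule eq_matI)
    fix i j assume "i < dim_row (mat n n (\<lambda>(i, j). f (Suc i) (Suc j)))"
      "j < dim_col (mat n n (\<lambda>(i, j). f (Suc i) (Suc j)))"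
    then have ij: "i < n" "j < n" by simp_all
    then have "(P * Q) $$ (i, j) = (\<Sum>a<r. p a (Suc i) * q a (Suc j))"
      unfolding P_def Q_def by (auto simp: scalar_prod_def lessThan_atLeast0 intro!: sum.cong)
    also have "\<dots> = f (Suc i) (Suc j)" using f[of "Suc i" "Suc j"] ij by (simp only: Suc_less_eq)
    finally show "(P * Q) $$ (i, j) = mat n n (\<lambda>(i, j). f (Suc i) (Suc j)) $$ (i, j)"
      using ij by simp
  qed (auto simp: P_def Q_def)
  ultimately show ?thesis by simp
qed

lemma sum_lessThan_add:
  fixes g :: "nat \<Rightarrow> 'a::comm_monoid_add"
  shows "(\<Sum>a<m + n. g a) = (\<Sum>a<m. g a) + (\<Sum>a<n. g (m + a))"
  by (induction n) (simp_all only: add_0_right add_Suc_right sum.lessThan_Suc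
      lessThan_0 sum.empty add.assoc)

text \<open>The dual functionals live on the two axes: on \<open>z mod N = 0\<close> the functions
  of the second factor vanish, on \<open>z div N = 0\<close> those of the first, so all mixed sums
  are zero.\<close>

lemma dual_tensor:
  assumes p: "dual M r p' p" and q: "dual N s q' q" and pos: "0 < M" "0 < N"
  defines "P \<equiv> \<lambda>a z. if a < r then p a (z div N) else q (a - r) (z mod N)"
  defines "P' \<equiv> \<lambda>a z. if a < r then of_bool (z mod N = 0) * p' a (z div N)
      else of_bool (z div N = 0) * q' (a - r) (z mod N)"
  shows "dual (M * N) (r + s) P' P"
  unfolding dual_def
proof (intro conjI allI impI)
  fix a assume "a < r + s"
  then show "P a 0 = 0" using p q by (auto simp: P_def dual_def)
next
  fix a b assume ab: "a < r + s" "b < r + s"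
  have p0: "p b 0 = 0" if "b < r" for b using p that by (auto simp: dual_def)
  have q0: "q b 0 = 0" if "b < s" for b using q that by (auto simp: dual_def)
  have delta_N: "(\<Sum>y<N. of_bool (y = 0) * h y) = h 0" for h :: "nat \<Rightarrow> bit"
  proof -
    have "(\<Sum>y<N. of_bool (y = 0) * h y) = (\<Sum>y<N. if y = 0 then h y else 0)"
      by (intro sum.cong) auto
    with pos show ?thesis by (simp only: sum.delta finite_lessThan lessThan_iff if_True)
  qed
  have delta_M: "(\<Sum>y<M. of_bool (y = 0) * h y) = h 0" for h :: "nat \<Rightarrow> bit"
  proof -
    have "(\<Sum>y<M. of_bool (y = 0) * h y) = (\<Sum>y<M. if y = 0 then h y else 0)"
      by (intro sum.cong) auto
    with pos show ?thesis by (simp only: sum.delta finite_lessThan lessThan_iff if_True)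
  qed
  show "(\<Sum>z<M * N. P' a z * P b z) = of_bool (a = b)"
  proof (cases "a < r")
    case True
    have "(\<Sum>z<M * N. P' a z * P b z) =
        (\<Sum>x<M. \<Sum>y<N. of_bool (y = 0) * (p' a x * (if b < r then p b x else q (b - r) y)))"
      unfolding sum_div_mod[symmetric] P_def P'_def using True by (simp only: if_True mult.assoc)
    also have "\<dots> = (\<Sum>x<M. p' a x * (if b < r then p b x else q (b - r) 0))"
      unfolding delta_N ..
    also have "\<dots> = of_bool (a = b)"
    proof (cases "b < r")
      case b: True
      with True p show ?thesis by (simp only: dual_def if_True)
    next
      case False
      then have "q (b - r) 0 = 0" "a \<noteq> b" using ab True q0 by auto
      with False show ?thesis by (simp only: if_False mult_zero_right sum.neutral_const of_bool_eq)
    qed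
    finally show ?thesis .
  next
    case False
    have "(\<Sum>z<M * N. P' a z * P b z) =
        (\<Sum>x<M. \<Sum>y<N. of_bool (x = 0) * (q' (a - r) y * (if b < r then p b x else q (b - r) y)))"
      unfolding sum_div_mod[symmetric] P_def P'_def using False by (simp only: if_False mult.assoc)
    also have "\<dots> = (\<Sum>y<N. q' (a - r) y * (if b < r then p b 0 else q (b - r) y))"
      unfolding sum_distrib_left[symmetric] delta_M ..
    also have "\<dots> = of_bool (a = b)"
    proof (cases "b < r")
      case True
      then have "p b 0 = 0" "a \<noteq> b" using ab False p0 by auto
      with True show ?thesis by (simp only: if_True mult_zero_right sum.neutral_const of_bool_eq)
    next
      case b: False
      have "a - r < s" "b - r < s" "(a - r = b - r) = (a = b)" using ab False b by auto
      with b q show ?thesis by (simp only: dual_def if_False)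
    qed
    finally show ?thesis .
  qed
qed

lemma has_rank_tensor:
  assumes f: "has_rank M r f" and g: "has_rank N s g" and pos: "0 < M" "0 < N"
  shows "has_rank (M * N) (r + s) (tensor N f g)"
proof -
  obtain p q p' q' where p: "dual M r p' p" and q: "dual M r q' q"
    and f: "\<And>x y. x < M \<Longrightarrow> y < M \<Longrightarrow> f x y = (\<Sum>a<r. p a x * q a y)"
    using f unfolding has_rank_def by blast
  obtain u v u' v' where u: "dual N s u' u" and v: "dual N s v' v"
    and g: "\<And>x y. x < N \<Longrightarrow> y < N \<Longrightarrow> g x y = (\<Sum>a<s. u a x * v a y)"
    using g unfolding has_rank_def by blast
  have "tensor N f g x y = (\<Sum>a<r + s. (if a < r then p a (x div N) else u (a - r) (x mod N)) *
      (if a < r then q a (y div N) else v (a - r) (y mod N)))"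
    if xy: "x < M * N" "y < M * N" for x y
  proof -
    have "tensor N f g x y = (\<Sum>a<r. p a (x div N) * q a (y div N)) + (\<Sum>a<s. u a (x mod N) * v a (y mod N))"
      unfolding tensor_def using f[of "x div N" "y div N"] g[of "x mod N" "y mod N"] xy pos
      by (simp only: less_mult_imp_div_less mod_less_divisor)
    also have "\<dots> = (\<Sum>a<r + s. (if a < r then p a (x div N) else u (a - r) (x mod N)) *
      (if a < r then q a (y div N) else v (a - r) (y mod N)))"
      unfolding sum_lessThan_add by (intro arg_cong2[where f = "(+)"] sum.cong) auto
    finally show ?thesis .
  qed
  then show ?thesis
    unfolding has_rank_def using dual_tensor[OF p u pos] dual_tensor[OF q v pos] by blast
qed

text \<open>The left factor is \<open>\<phi>\<close>; the right factor is \<open>\<phi>\<close> with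
  the two members of each pair exchanged by \<open>\<sigma>\<close>, and its dual system is permuted
  alike.\<close>

lemma has_rank_alt_form:
  assumes "dual N (2 * n) \<psi> \<phi>"
  shows "has_rank N (2 * n) (alt_form n \<phi>)"
proof -
  define \<sigma> where "\<sigma> a = (if even a then a + 1 else a - 1)" for a :: nat
  have \<sigma>: "\<sigma> a < 2 * n" if "a < 2 * n" for a
    using that by (auto simp: \<sigma>_def elim!: evenE)
  have inj: "\<sigma> a = \<sigma> b \<longleftrightarrow> a = b" for a b
    unfolding \<sigma>_def by (cases "even a"; cases "even b"; simp) presburger+
  have "dual N (2 * n) (\<lambda>a. \<psi> (\<sigma> a)) (\<lambda>a. \<phi> (\<sigma> a))"
    unfolding dual_def
  proof (intro conjI allI impI)
    fix a b assume ab: "a < 2 * n" "b < 2 * n"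
    have "(\<Sum>x<N. \<psi> (\<sigma> a) x * \<phi> (\<sigma> b) x) = of_bool (\<sigma> a = \<sigma> b)"
      using assms \<sigma>[OF ab(1)] \<sigma>[OF ab(2)] unfolding dual_def by blast
    then show "(\<Sum>x<N. \<psi> (\<sigma> a) x * \<phi> (\<sigma> b) x) = of_bool (a = b)"
      unfolding inj .
  next
    fix a assume "a < 2 * n"
    then show "\<phi> (\<sigma> a) 0 = 0" using assms \<sigma> unfolding dual_def by blast
  qed
  moreover have "alt_form n \<phi> x y = (\<Sum>a<2 * n. \<phi> a x * \<phi> (\<sigma> a) y)" for x y
  proof (induction n)
    case (Suc n)
    have "2 * Suc n = Suc (Suc (2 * n))" "\<sigma> (2 * n) = Suc (2 * n)" "\<sigma> (Suc (2 * n)) = 2 * n"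
      by (simp_all add: \<sigma>_def)
    with Suc show ?case
      by (simp only: alt_form_def sum.lessThan_Suc Suc_eq_plus1[symmetric] add.assoc)
  qed (simp add: alt_form_def)
  ultimately show ?thesis unfolding has_rank_def using assms by blast
qed

section \<open>From Hadamard matrices to graphs\<close>

text \<open>The zero row at point 0 is carried by \<open>has_rank\<close>, whose factors vanish
  there.\<close>

definition graphical :: "nat \<Rightarrow> nat \<Rightarrow> (nat \<Rightarrow> nat \<Rightarrow> bit) \<Rightarrow> bool" where
  "graphical N r f \<longleftrightarrow> hadamard N f \<and> has_rank N r f \<and>
    (\<forall>x<N. f x x = 0) \<and> (\<forall>x<N. \<forall>y<N. f x y = f y x)"

lemma has_rank_zero_row:
  assumes "has_rank N r f" and "y < N"
  shows "f 0 y = 0"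
proof -
  obtain p q p' where "dual N r p' p" "\<And>x y. x < N \<Longrightarrow> y < N \<Longrightarrow> f x y = (\<Sum>a<r. p a x * q a y)"
    using assms(1) unfolding has_rank_def by blast
  moreover have "p a 0 * q a y = 0" if "a \<in> {..<r}" for a
    using \<open>dual N r p' p\<close> that by (simp add: dual_def)
  ultimately show ?thesis using assms(2) by (metis (no_types, lifting) sum.neutral gr_zeroI less_nat_zero_code)
qed

lemma graphical_tensor:
  assumes "graphical M r f" and "graphical N s g" and "0 < M" and "0 < N"
  shows "graphical (M * N) (r + s) (tensor N f g)"
  using assms unfolding graphical_def
  by (auto simp: hadamard_tensor has_rank_tensor tensor_def less_mult_imp_div_less)

lemma graphical_alt_form:
  assumes "hadamard N (alt_form n \<phi>)" and "dual N (2 * n) \<psi> \<phi>"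
  shows "graphical N (2 * n) (alt_form n \<phi>)"
  using assms has_rank_alt_form alt_form_sym unfolding graphical_def by simp

text \<open>Orthogonality to the zero row fixes the degree; orthogonality of two other rows then
  fixes the number of common neighbours, adjacent or not, whence the equal last two
  parameters.\<close>

lemma graphical_srg:
  assumes f: "graphical (4 * n) r f" and "0 < n"
  shows "\<exists>G :: nat pair_pre_digraph. strongly_regular_graph G (4 * n - 1) (2 * n) n n \<and> two_rank G = r"
proof -
  define G where "G = \<lparr>pverts = {1..<4 * n}, parcs = {(x, y). x \<in> {1..<4 * n} \<and> y \<in> {1..<4 * n} \<and> f x y = 1}\<rparr>"
  define nb where "nb x = {z. z < 4 * n \<and> f x z = 1}" for x
  have sym: "f x y = f y x" if "x < 4 * n" "y < 4 * n" for x y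
    using f that by (auto simp: graphical_def)
  have diag: "f x x = 0" if "x < 4 * n" for x
    using f that by (auto simp: graphical_def)
  have zero: "f 0 y = 0" if "y < 4 * n" for y
    using f that has_rank_zero_row by (auto simp: graphical_def)
  have fin: "finite (nb x)" for x by (simp add: nb_def)
  have orth: "(\<Sum>z<4 * n. signed (f x z) * signed (f y z)) = 0"
    if "x < 4 * n" "y < 4 * n" "x \<noteq> y" for x y
    using f that unfolding graphical_def hadamard_def by blast
  \<comment> \<open>For indicators,
    \<open>(1 - 2 * a) * (1 - 2 * b) = 1 - 2 * a - 2 * b + 4 * a * b\<close>.\<close>
  have expand: "(\<Sum>z<4 * n. signed (f x z) * signed (f y z))
      = int (4 * n) - 2 * int (card (nb x)) - 2 * int (card (nb y)) + 4 * int (card (nb x \<inter> nb y))" for x y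
  proof -
    have "(\<Sum>z<4 * n. signed (f x z) * signed (f y z)) = (\<Sum>z<4 * n. 1 - 2 * of_bool (z \<in> nb x)
        - 2 * of_bool (z \<in> nb y) + 4 * of_bool (z \<in> nb x \<inter> nb y))"
      by (intro sum.cong refl) (auto simp: nb_def signed_def)
    moreover have "{..<4 * n} \<inter> nb x = nb x" "{..<4 * n} \<inter> nb y = nb y"
        "{..<4 * n} \<inter> (nb x \<inter> nb y) = nb x \<inter> nb y"
      by (auto simp: nb_def)
    ultimately show ?thesis
      by (simp add: sum.distrib sum_subtractf sum_distrib_left[symmetric] del: Int_iff)
  qed
  have deg: "card (nb x) = 2 * n" if "x \<in> {1..<4 * n}" for x
  proof -
    have "nb 0 = {}" using zero by (auto simp: nb_def)
    with expand[of 0 x] orth[of 0 x] that show ?thesis by simp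
  qed
  have common: "card (nb x \<inter> nb y) = n" if "x \<in> {1..<4 * n}" "y \<in> {1..<4 * n}" "x \<noteq> y" for x y
  proof -
    have "int (4 * n) - 2 * int (card (nb x)) - 2 * int (card (nb y)) + 4 * int (card (nb x \<inter> nb y)) = 0"
      unfolding expand[symmetric] using that by (intro orth) auto
    with deg[OF that(1)] deg[OF that(2)] show ?thesis by linarith
  qed
  \<comment> \<open>By symmetry column 0 is zero too, so deleting point 0 loses no
    neighbour.\<close>
  have nb_pos: "z \<in> {1..<4 * n}" if "z \<in> nb x" "x < 4 * n" for x z
  proof -
    have "z \<noteq> 0" using that zero[of x] sym[of x 0] assms(2) by (auto simp: nb_def intro: gr0I)
    with that show ?thesis by (auto simp: nb_def)
  qed
  have arcs: "(x, z) \<in> parcs G \<longleftrightarrow> z \<in> nb x" if "x \<in> {1..<4 * n}" for x z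
    using that nb_pos[of z x] by (auto simp: G_def nb_def)
  have common_G: "{z \<in> pverts G. (x, z) \<in> parcs G \<and> (y, z) \<in> parcs G} = nb x \<inter> nb y"
    if "x \<in> {1..<4 * n}" "y \<in> {1..<4 * n}" for x y
    using that arcs nb_pos by (auto simp: G_def)
  have "pair_graph G"
  proof
    show "finite (parcs G)"
      by (rule finite_subset[of _ "{1..<4 * n} \<times> {1..<4 * n}"]) (auto simp: G_def)
    show "symmetric (with_proj G)"
      unfolding symmetric_def by (intro symI) (auto simp: G_def sym arcs_ends_def arc_to_ends_def image_iff)
  qed (auto simp: G_def diag)
  then interpret pair_graph G .
  have "strongly_regular_graph G (4 * n - 1) (2 * n) n n"
  proof
    fix x assume x: "x \<in> pverts G"
    then have x': "x \<in> {1..<4 * n}" by (simp add: G_def)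
    have "out_arcs (with_proj G) x = Pair x ` nb x"
      using x' nb_pos by (auto simp: out_arcs_def G_def nb_def)
    then show "out_degree (with_proj G) x = 2 * n"
      using deg[OF x'] by (simp add: out_degree_def card_image inj_on_def)
  next
    fix x y assume xy: "x \<in> pverts G" "y \<in> pverts G" "(x, y) \<in> parcs G"
    then have "x \<in> {1..<4 * n}" "y \<in> {1..<4 * n}" "x \<noteq> y" by (auto simp: G_def diag)
    then show "card {z \<in> pverts G. (x, z) \<in> parcs G \<and> (y, z) \<in> parcs G} = n"
      using common_G[of x y] common[of x y] by simp
  next
    fix x y assume xy: "x \<in> pverts G" "y \<in> pverts G" "x \<noteq> y"
    then have "x \<in> {1..<4 * n}" "y \<in> {1..<4 * n}" by (auto simp: G_def)
    with xy(3) show "card {z \<in> pverts G. (x, z) \<in> parcs G \<and> (y, z) \<in> parcs G} = n"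
      using common_G[of x y] common[of x y] by simp
  qed (auto simp: G_def)
  moreover have "two_rank G = r"
  proof -
    \<comment> \<open>The sorted vertices start at 1, hence the shift by \<open>Suc\<close>.\<close>
    have "(adjacency_matrix G :: bit mat) = mat (4 * n - 1) (4 * n - 1) (\<lambda>(i, j). f (Suc i) (Suc j))"
      unfolding adjacency_matrix_def Let_def by (rule eq_matI) (auto simp: G_def)
    then show ?thesis
      using rank_mat_bit[of "4 * n - 1" r f] f assms(2)
      by (simp add: two_rank_def G_def graphical_def)
  qed
  ultimately show ?thesis by blast
qed

section \<open>Repeated switching\<close>

text \<open>
  Appends the pairs \<open>(d, s)\<close> of the quadruples to \<open>\<phi>\<close>, so that each switching adds one hyperbolic
  pair to \<open>alt_form\<close>.
\<close>

definition extend :: "nat \<Rightarrow> (nat \<Rightarrow> nat \<Rightarrow> bit) \<Rightarrow> (nat \<Rightarrow> nat set) \<Rightarrow> nat \<Rightarrow> nat \<Rightarrow> bit" where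
  "extend m \<phi> D a x = (if a < 2 * m then \<phi> a x
    else if even a then of_bool (x \<in> D (a div 2 - m))
    else splits (alt_form m \<phi>) (D (a div 2 - m)) x)"

lemma alt_form_Suc:
  "alt_form (Suc n) \<phi> x y =
    alt_form n \<phi> x y + (\<phi> (2 * n) x * \<phi> (2 * n + 1) y + \<phi> (2 * n + 1) x * \<phi> (2 * n) y)"
  unfolding alt_form_def by (simp only: sum.lessThan_Suc)

lemma alt_form_extend_0: "alt_form m (extend m \<phi> D) = alt_form m \<phi>"
  unfolding alt_form_def by (intro ext sum.cong refl) (auto simp: extend_def)

lemma alt_form_extend_Suc:
  "alt_form (m + Suc k) (extend m \<phi> D) =
    switch (D k) (splits (alt_form m \<phi>) (D k)) (alt_form (m + k) (extend m \<phi> D))"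
proof (intro ext)
  fix x y
  have "extend m \<phi> D (2 * (m + k)) z = of_bool (z \<in> D k)"
    "extend m \<phi> D (2 * (m + k) + 1) z = splits (alt_form m \<phi>) (D k) z" for z
    by (simp_all add: extend_def)
  then show "alt_form (m + Suc k) (extend m \<phi> D) x y =
      switch (D k) (splits (alt_form m \<phi>) (D k)) (alt_form (m + k) (extend m \<phi> D)) x y"
    by (simp only: add_Suc_right alt_form_Suc switch_def)
qed

text \<open>For \<open>y\<close> outside the earlier quadruples only one half of each switching term
  survives. It is meant for \<open>y\<close> in the next quadruple.\<close>

lemma alt_form_extend_on_quad:
  assumes "\<And>i. i < k \<Longrightarrow> y \<notin> D i"
  shows "alt_form (m + k) (extend m \<phi> D) x y =
    alt_form m \<phi> x y + (\<Sum>i<k. of_bool (x \<in> D i) * splits (alt_form m \<phi>) (D i) y)"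
  using assms
proof (induction k)
  case 0
  show ?case by (simp add: alt_form_extend_0)
next
  case (Suc k)
  have y: "y \<in> D k \<longleftrightarrow> False" using Suc.prems by simp
  have IH: "alt_form (m + k) (extend m \<phi> D) x y =
      alt_form m \<phi> x y + (\<Sum>i<k. of_bool (x \<in> D i) * splits (alt_form m \<phi>) (D i) y)"
    using Suc.prems by (intro Suc.IH) auto
  show ?case
    unfolding alt_form_extend_Suc switch_def sum.lessThan_Suc IH y
    by (simp only: of_bool_eq mult_zero_right add_0_right add.assoc)
qed

text \<open>By \<open>disj\<close> and \<open>const\<close>, earlier switchings change row
  \<open>x\<close> on the next quadruple by a constant \<open>c x\<close>, so the conditions for
  switching and the function \<open>splits\<close> stay those of the original form.\<close>

lemma hadamard_extend:
  assumes base: "hadamard N (alt_form m \<phi>)"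
    and D: "\<And>i. i < t \<Longrightarrow> D i \<subseteq> {..<N}" "\<And>i. i < t \<Longrightarrow> card (D i) = 4"
    and DD: "\<And>i x y. i < t \<Longrightarrow> x \<in> D i \<Longrightarrow> y \<in> D i \<Longrightarrow> alt_form m \<phi> x y = 0"
    and even: "\<And>i x. i < t \<Longrightarrow> (\<Sum>y\<in>D i. alt_form m \<phi> x y) = 0"
    and disj: "\<And>i j. i < t \<Longrightarrow> j < t \<Longrightarrow> i \<noteq> j \<Longrightarrow> D i \<inter> D j = {}"
    and const: "\<And>i j x y. i < t \<Longrightarrow> j < t \<Longrightarrow> i \<noteq> j \<Longrightarrow> x \<in> D j \<Longrightarrow> y \<in> D j \<Longrightarrow>
      splits (alt_form m \<phi>) (D i) x = splits (alt_form m \<phi>) (D i) y"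
    and "k \<le> t"
  shows "hadamard N (alt_form (m + k) (extend m \<phi> D))"
  using \<open>k \<le> t\<close>
proof (induction k)
  case 0
  then show ?case using base by (simp add: alt_form_extend_0)
next
  case (Suc k)
  then have k: "k < t" by simp
  let ?f = "alt_form (m + k) (extend m \<phi> D)"
  \<comment> \<open>The chosen point merely represents \<open>D k\<close>; by \<open>const\<close>
    any other gives the same sum.\<close>
  define c where "c x = (\<Sum>i<k. of_bool (x \<in> D i) * splits (alt_form m \<phi>) (D i) (SOME y. y \<in> D k))" for x
  have f: "?f x y = alt_form m \<phi> x y + c x" if y: "y \<in> D k" for x y
  proof -
    have y0: "(SOME y. y \<in> D k) \<in> D k" using y by (rule someI)
    have "splits (alt_form m \<phi>) (D i) y = splits (alt_form m \<phi>) (D i) (SOME y. y \<in> D k)" if "i < k" for i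
      using that k by (intro const[OF _ k _ y y0]) auto
    then have "(\<Sum>i<k. of_bool (x \<in> D i) * splits (alt_form m \<phi>) (D i) y) = c x"
      unfolding c_def by (intro sum.cong refl) (simp only: lessThan_iff)
    moreover have "y \<notin> D i" if "i < k" for i
      using disj[of i k] that k y by auto
    then have "alt_form (m + k) (extend m \<phi> D) x y =
        alt_form m \<phi> x y + (\<Sum>i<k. of_bool (x \<in> D i) * splits (alt_form m \<phi>) (D i) y)"
      by (rule alt_form_extend_on_quad)
    ultimately show ?thesis by (simp only:)
  qed
  show ?case
    unfolding alt_form_extend_Suc
  proof (rule hadamard_switch)
    show "hadamard N ?f" using Suc by simp
    show "?f x y = ?f y x" for x y by (rule alt_form_sym)
    show "D k \<subseteq> {..<N}" "card (D k) = 4" using D k by auto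
    show "?f x y = 0" if "x \<in> D k" "y \<in> D k" for x y
    proof -
      have "of_bool (x \<in> D i) * splits (alt_form m \<phi>) (D i) (SOME y. y \<in> D k) = 0" if "i \<in> {..<k}" for i
        using disj[of i k] that k \<open>x \<in> D k\<close> by auto
      then have "c x = 0" unfolding c_def by (intro sum.neutral ballI)
      with f[OF that(2), of x] DD[OF k that] show ?thesis by (simp only: add_0_left)
    qed
    \<comment> \<open>\<open>c x\<close> is added four times, which is zero in characteristic
      2.\<close>
    show "(\<Sum>y\<in>D k. ?f x y) = 0" for x
    proof -
      have "(\<Sum>y\<in>D k. ?f x y) = (\<Sum>y\<in>D k. alt_form m \<phi> x y) + (\<Sum>y\<in>D k. c x)"
        unfolding sum.distrib[symmetric] by (intro sum.cong refl f)
      also have "(\<Sum>y\<in>D k. c x) = 0" using D(2)[OF k] by simp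
      also have "(\<Sum>y\<in>D k. alt_form m \<phi> x y) + 0 = 0"
        unfolding even[OF k] by (rule add_0_left)
      finally show ?thesis .
    qed
    show "splits (alt_form m \<phi>) (D k) x = splits ?f (D k) x" for x
      unfolding splits_def by (simp only: f add_right_cancel cong: bex_cong)
  qed
qed

section \<open>Six quadruples in the symplectic graph on 63 vertices\<close>

text \<open>
  Each quadruple is \<open>{a, b, c, a + b + c}\<close> for a totally isotropic subspace spanned by \<open>a, b, c\<close>.
  The six were found by a computer search.
\<close>

definition quads :: "nat \<Rightarrow> nat set" where
  "quads i = [{12, 13, 44, 45}, {3, 11, 19, 27}, {35, 43, 49, 57},
    {48, 50, 52, 54}, {7, 14, 39, 46}, {28, 30, 56, 58}] ! i"

lemma all_less_6: "(\<forall>i<6. P i) \<longleftrightarrow> P 0 \<and> P 1 \<and> P 2 \<and> P 3 \<and> P 4 \<and> P (5 :: nat)"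
  by (simp add: numeral_eq_Suc All_less_Suc) blast

lemma quads_simps:
  "quads 0 = {12, 13, 44, 45}" "quads 1 = {3, 11, 19, 27}" "quads 2 = {35, 43, 49, 57}"
  "quads 3 = {48, 50, 52, 54}" "quads 4 = {7, 14, 39, 46}" "quads 5 = {28, 30, 56, 58}"
  by (simp_all add: quads_def)

lemma symplectic_3:
  "alt_form 3 coord x y = coord 0 x * coord 1 y + coord 1 x * coord 0 y + (coord 2 x * coord 3 y
    + coord 3 x * coord 2 y + (coord 4 x * coord 5 y + coord 5 x * coord 4 y))"
  unfolding alt_form_def by (simp add: numeral_eq_Suc add.assoc del: Z2.add_bit_eq_xor)

lemma coord_numeral [simp]:
  "coord a 0 = 0" "coord a 1 = of_bool (a = 0)"
  "coord a (numeral n) = of_bool (odd (numeral n div 2 ^ a :: nat))"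
  by (simp_all add: coord_def bit_1_iff bit_iff_odd del: One_nat_def)

lemma symplectic_neq: "alt_form m coord x a \<noteq> alt_form m coord x b \<longleftrightarrow>
    alt_form m coord x (Bit_Operations.xor a b) = 1"
  unfolding symplectic_xor by (cases "alt_form m coord x a"; cases "alt_form m coord x b") simp_all

lemma bex_quad_neq:
  "(\<exists>y\<in>{a, b, c, e}. \<exists>z\<in>{a, b, c, e}. g y \<noteq> g z) \<longleftrightarrow> g a \<noteq> g b \<or> g a \<noteq> g c \<or> g a \<noteq> g e"
  by (simp only: bex_simps) metis

text \<open>By linearity, comparing the values at two points means evaluating at their sum;
  comparisons with \<open>a\<close> suffice.\<close>

lemma splits_symplectic_quad:
  "splits (alt_form m coord) {a, b, c, e} x = of_bool (alt_form m coord x (Bit_Operations.xor a b) = 1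
    \<or> alt_form m coord x (Bit_Operations.xor a c) = 1 \<or> alt_form m coord x (Bit_Operations.xor a e) = 1)"
  unfolding splits_def symplectic_neq[symmetric] bex_quad_neq ..

text \<open>The differences from the first point are \<open>u\<close>, \<open>w\<close> and
  \<open>u + w\<close>; a value 1 at \<open>u + w\<close> forces a value 1 at \<open>u\<close> or
  \<open>w\<close>, so two functionals remain.\<close>

lemma splits_quads:
  "splits (alt_form 3 coord) (quads 0) x = of_bool (coord 1 x = 1 \<or> coord 4 x = 1)"
  "splits (alt_form 3 coord) (quads 1) x = of_bool (coord 2 x = 1 \<or> coord 5 x = 1)"
  "splits (alt_form 3 coord) (quads 2) x = of_bool (coord 2 x = 1 \<or> coord 0 x \<noteq> coord 5 x)"
  "splits (alt_form 3 coord) (quads 3) x = of_bool (coord 0 x = 1 \<or> coord 3 x = 1)"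
  "splits (alt_form 3 coord) (quads 4) x = of_bool (coord 4 x = 1 \<or> coord 1 x \<noteq> coord 2 x)"
  "splits (alt_form 3 coord) (quads 5) x = of_bool (coord 0 x = 1 \<or> coord 3 x \<noteq> coord 4 x)"
  unfolding quads_simps splits_symplectic_quad symplectic_3
  by (auto simp del: One_nat_def)

text \<open>Linearity turns the sum into the value at the sum of the four points.\<close>

lemma sum_symplectic_quad:
  assumes "distinct [a, b, c, e]" and "Bit_Operations.xor a (Bit_Operations.xor b (Bit_Operations.xor c e)) = 0"
  shows "(\<Sum>y\<in>{a, b, c, e}. alt_form m coord x y) = 0"
proof -
  have "(\<Sum>y\<in>{a, b, c, e}. alt_form m coord x y) =
      alt_form m coord x (Bit_Operations.xor a (Bit_Operations.xor b (Bit_Operations.xor c e)))"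
    using assms(1) by (simp add: symplectic_xor del: Z2.add_bit_eq_xor)
  also have "\<dots> = 0"
    unfolding assms(2) alt_form_def by (intro sum.neutral) (simp add: coord_def)
  finally show ?thesis .
qed

lemma quads_even: "\<forall>i<6. (\<Sum>y\<in>quads i. alt_form 3 coord x y) = 0"
  unfolding all_less_6 quads_simps
  by (intro conjI sum_symplectic_quad) (simp_all del: One_nat_def)

lemma quads_facts:
  "\<forall>i<6. quads i \<subseteq> {..<64}"
  "\<forall>i<6. card (quads i) = 4"
  "\<forall>i<6. \<forall>x\<in>quads i. \<forall>y\<in>quads i. alt_form 3 coord x y = 0"
  "\<forall>i<6. \<forall>j<6. i \<noteq> j \<longrightarrow> quads i \<inter> quads j = {}"
  unfolding all_less_6 quads_simps symplectic_3 by (simp_all del: One_nat_def)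

text \<open>This is the hypothesis \<open>const\<close> of \<open>hadamard_extend\<close>; the
  coordinate formulas reduce it to reading binary digits.\<close>

lemma splits_quads_const:
  "\<forall>i<6. \<forall>j<6. i \<noteq> j \<longrightarrow> (\<forall>x\<in>quads j. \<forall>y\<in>quads j.
      splits (alt_form 3 coord) (quads i) x = splits (alt_form 3 coord) (quads i) y)"
  unfolding all_less_6 splits_quads unfolding quads_simps
  by (simp del: One_nat_def)

text \<open>
  Summation over the points of \<open>dual_points a\<close> is the functional dual to the \<open>a\<close>-th of the 18
  functions; these sets come from inverting an evaluation matrix.
\<close>

definition dual_points :: "nat \<Rightarrow> nat set" where
  "dual_points a = [{8, 13, 20, 44, 60}, {16, 18}, {8, 16, 32, 60}, {1, 32, 41}, {2, 41, 59},
    {8, 20, 60}, {4, 20, 44, 60}, {2, 4, 18, 20}, {1, 2, 3}, {8, 13, 41, 44}, {16, 18, 57, 59},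
    {13, 20, 32, 41, 44, 60}, {18, 32, 50}, {1, 8, 18, 32, 59}, {2, 4, 8, 14}, {4, 16, 20},
    {8, 16, 32, 56}, {18, 41, 59}] ! a"

lemma all_less_18:
  "(\<forall>a<18. P a) \<longleftrightarrow> P 0 \<and> P 1 \<and> P 2 \<and> P 3 \<and> P 4 \<and> P 5 \<and> P 6 \<and> P 7 \<and> P 8 \<and> P 9 \<and> P 10 \<and>
    P 11 \<and> P 12 \<and> P 13 \<and> P 14 \<and> P 15 \<and> P 16 \<and> P (17 :: nat)"
  by (simp add: numeral_eq_Suc All_less_Suc) blast

lemma dual_points_simps:
  "dual_points 0 = {8, 13, 20, 44, 60}" "dual_points 1 = {16, 18}"
  "dual_points 2 = {8, 16, 32, 60}" "dual_points 3 = {1, 32, 41}" "dual_points 4 = {2, 41, 59}"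
  "dual_points 5 = {8, 20, 60}" "dual_points 6 = {4, 20, 44, 60}" "dual_points 7 = {2, 4, 18, 20}"
  "dual_points 8 = {1, 2, 3}" "dual_points 9 = {8, 13, 41, 44}" "dual_points 10 = {16, 18, 57, 59}"
  "dual_points 11 = {13, 20, 32, 41, 44, 60}" "dual_points 12 = {18, 32, 50}"
  "dual_points 13 = {1, 8, 18, 32, 59}" "dual_points 14 = {2, 4, 8, 14}"
  "dual_points 15 = {4, 16, 20}" "dual_points 16 = {8, 16, 32, 56}" "dual_points 17 = {18, 41, 59}"
  by (simp_all add: dual_points_def)

lemma extend_quads_simps:
  "a < 6 \<Longrightarrow> extend 3 coord quads a x = coord a x"
  "extend 3 coord quads 6 x = of_bool (x \<in> {12, 13, 44, 45})"
  "extend 3 coord quads 7 x = of_bool (coord 1 x = 1 \<or> coord 4 x = 1)"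
  "extend 3 coord quads 8 x = of_bool (x \<in> {3, 11, 19, 27})"
  "extend 3 coord quads 9 x = of_bool (coord 2 x = 1 \<or> coord 5 x = 1)"
  "extend 3 coord quads 10 x = of_bool (x \<in> {35, 43, 49, 57})"
  "extend 3 coord quads 11 x = of_bool (coord 2 x = 1 \<or> coord 0 x \<noteq> coord 5 x)"
  "extend 3 coord quads 12 x = of_bool (x \<in> {48, 50, 52, 54})"
  "extend 3 coord quads 13 x = of_bool (coord 0 x = 1 \<or> coord 3 x = 1)"
  "extend 3 coord quads 14 x = of_bool (x \<in> {7, 14, 39, 46})"
  "extend 3 coord quads 15 x = of_bool (coord 4 x = 1 \<or> coord 1 x \<noteq> coord 2 x)"
  "extend 3 coord quads 16 x = of_bool (x \<in> {28, 30, 56, 58})"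
  "extend 3 coord quads 17 x = of_bool (coord 0 x = 1 \<or> coord 3 x \<noteq> coord 4 x)"
  unfolding extend_def splits_quads[symmetric] quads_simps[symmetric] by simp_all

lemma dual_points_dual:
  "\<forall>a<18. \<forall>b<18. (\<Sum>x\<in>dual_points a. extend 3 coord quads b x) = of_bool (a = b)"
  unfolding all_less_18 dual_points_simps
  by (simp add: extend_quads_simps del: One_nat_def)

lemma dual_points_subset: "\<forall>a<18. dual_points a \<subseteq> {..<64}"
  unfolding all_less_18 dual_points_simps by simp

text \<open>One system of 18 functionals serves every \<open>k\<close>, because duality restricts to
  initial segments of the family.\<close>

lemma dual_extend_quads:
  assumes "k \<le> 6"
  shows "dual 64 (2 * (3 + k)) (\<lambda>a x. of_bool (x \<in> dual_points a)) (extend 3 coord quads)"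
  unfolding dual_def
proof (intro conjI allI impI)
  have zero: "\<forall>a<18. extend 3 coord quads a 0 = 0"
    unfolding all_less_18 by (simp add: extend_quads_simps del: One_nat_def)
  fix a assume "a < 2 * (3 + k)"
  then show "extend 3 coord quads a 0 = 0" using zero assms by simp
next
  fix a b assume "a < 2 * (3 + k)" "b < 2 * (3 + k)"
  then have ab: "a < 18" "b < 18" using assms by simp_all
  have "(\<Sum>x<64. of_bool (x \<in> dual_points a) * extend 3 coord quads b x) =
      (\<Sum>x\<in>dual_points a. of_bool (x \<in> dual_points a) * extend 3 coord quads b x)"
    using dual_points_subset ab by (intro sum.mono_neutral_right) auto
  also have "\<dots> = (\<Sum>x\<in>dual_points a. extend 3 coord quads b x)"
    by (intro sum.cong refl) (simp only: of_bool_eq mult_1_left)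
  also have "\<dots> = of_bool (a = b)" using dual_points_dual ab by blast
  finally show "(\<Sum>x<64. of_bool (x \<in> dual_points a) * extend 3 coord quads b x) = of_bool (a = b)" .
qed

section \<open>Blocks of order 64 and 4, and their tensor products\<close>

lemma graphical_64:
  assumes "even r" and "6 \<le> r" and "r \<le> 18"
  shows "\<exists>f. graphical 64 r f"
proof -
  \<comment> \<open>\<open>k\<close> counts the switchings.\<close>
  obtain k where k: "r = 2 * (3 + k)" "k \<le> 6"
  proof -
    obtain c where "r = 2 * c" using assms(1) by blast
    with assms that[of "c - 3"] show ?thesis by simp
  qed
  have "hadamard 64 (alt_form 3 coord)"
    using hadamard_symplectic[of 3] by simp
  then have "hadamard 64 (alt_form (3 + k) (extend 3 coord quads))"
  proof (rule hadamard_extend[where t = 6])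
    fix i j x y assume ij: "i < 6" "j < 6" "i \<noteq> j" and "x \<in> quads j" "y \<in> quads j"
    then show "splits (alt_form 3 coord) (quads i) x = splits (alt_form 3 coord) (quads i) y"
      using splits_quads_const by blast
  next
    fix i j :: nat assume "i < 6" "j < 6" "i \<noteq> j"
    then show "quads i \<inter> quads j = {}" using quads_facts(4) by blast
  qed (use quads_facts(1-3) quads_even k in blast)+
  with k dual_extend_quads graphical_alt_form show ?thesis by blast
qed

lemma graphical_4: "graphical 4 2 (alt_form 1 coord)"
proof -
  \<comment> \<open>The points 1 and 2 are the unit vectors; evaluation at them reads the
    coordinates.\<close>
  have "dual 4 (2 * 1) (\<lambda>a x. of_bool (x = 2 ^ a)) coord"
  proof -
    have less_2: "(\<forall>a<2 * 1. P a) \<longleftrightarrow> P 0 \<and> P 1" for P :: "nat \<Rightarrow> bool"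
      by (auto simp: less_2_cases_iff)
    have "{..<4} = {0, 1, 2, 3 :: nat}" by auto
    then show ?thesis unfolding dual_def less_2 by (simp del: One_nat_def)
  qed
  then show ?thesis using hadamard_symplectic[of 1] graphical_alt_form[of 4 1 coord] by simp
qed

text \<open>Tensor factors are peeled off: order 64 while \<open>\<nu> \<ge> 3\<close>, then order
  4, down to the zero form on one point.\<close>

lemma graphical_exists:
  assumes "even r" and "2 * \<nu> \<le> r" and "r \<le> 2 * \<nu> + 12 * (\<nu> div 3)"
  shows "\<exists>f. graphical (4 ^ \<nu>) r f"
  using assms
proof (induction \<nu> arbitrary: r rule: less_induct)
  case (less \<nu>)
  consider "\<nu> = 0" | "\<nu> \<noteq> 0" "\<nu> < 3" | "3 \<le> \<nu>" by linarith
  then show ?case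
  proof cases
    case 1
    then have "graphical (4 ^ \<nu>) r (alt_form 0 coord)"
      using less.prems by (simp add: graphical_def hadamard_def has_rank_def dual_def alt_form_def)
    then show ?thesis by blast
  next
    case 2
    \<comment> \<open>Here \<open>\<nu> div 3 = 0\<close> forces
      \<open>r = 2 * \<nu>\<close>.\<close>
    then have "even (r - 2)" "2 * (\<nu> - 1) \<le> r - 2" "r - 2 \<le> 2 * (\<nu> - 1) + 12 * ((\<nu> - 1) div 3)"
      using less.prems by auto
    with 2 less.IH[of "\<nu> - 1" "r - 2"] obtain f where "graphical (4 ^ (\<nu> - 1)) (r - 2) f" by auto
    then have "graphical (4 ^ (\<nu> - 1) * 4) (r - 2 + 2) (tensor 4 f (alt_form 1 coord))"
      by (intro graphical_tensor graphical_4) auto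
    moreover have "4 ^ (\<nu> - 1) * 4 = (4 ^ \<nu> :: nat)" "r - 2 + 2 = r"
      using 2 less.prems by (auto simp flip: power_Suc2)
    ultimately show ?thesis by metis
  next
    case 3
    \<comment> \<open>Greedy choice: the block takes as much rank as it can, up to 18, but leaves
      the minimum \<open>2 * (\<nu> - 3)\<close> to the rest; \<open>r \<ge> 2 * \<nu>\<close> gives
      \<open>s \<ge> 6\<close>.\<close>
    define s where "s = min 18 (r - 2 * (\<nu> - 3))"
    \<comment> \<open>Passing to \<open>\<nu> - 3\<close> lowers the upper bound by 6 + 12 = 18, the
      largest rank of a block.\<close>
    have "\<nu> div 3 = (\<nu> - 3) div 3 + 1" using 3 by presburger
    with less.prems(3) 3 have r: "r \<le> 2 * (\<nu> - 3) + 12 * ((\<nu> - 3) div 3) + 18" by linarith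
    have s: "even s" "6 \<le> s" "s \<le> 18" "s \<le> r"
      using less.prems 3 by (auto simp: s_def min_def)
    moreover have "even (r - s)" "2 * (\<nu> - 3) \<le> r - s" "r - s \<le> 2 * (\<nu> - 3) + 12 * ((\<nu> - 3) div 3)"
      using less.prems(1,2) 3 s r by (auto simp: s_def min_def)
    ultimately obtain f g where "graphical (4 ^ (\<nu> - 3)) (r - s) f" "graphical 64 s g"
      using less.IH[of "\<nu> - 3" "r - s"] 3 graphical_64[of s] by auto
    then have "graphical (4 ^ (\<nu> - 3) * 64) (r - s + s) (tensor 64 f g)"
      by (intro graphical_tensor) auto
    moreover have "4 ^ (\<nu> - 3) * 64 = (4 ^ \<nu> :: nat)"
    proof -
      have "(4 :: nat) ^ \<nu> = 4 ^ (\<nu> - 3 + 3)" using 3 by simp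
      then show ?thesis unfolding power_add by simp
    qed
    ultimately show ?thesis using s(4) by auto
  qed
qed

theorem theorem4p2:
  fixes \<nu> :: nat
  assumes "\<nu> > 0"
  shows "\<forall>r::nat. even r \<and> 2 * \<nu> \<le> r \<and> r \<le> 2 * \<nu> + 12 * (\<nu> div 3) \<longrightarrow>
    (\<exists>G :: nat pair_pre_digraph.
       strongly_regular_graph G (2 ^ (2 * \<nu>) - 1) (2 ^ (2 * \<nu> - 1)) (2 ^ (2 * \<nu> - 2)) (2 ^ (2 * \<nu> - 2)) \<and>
       two_rank G = r)"
proof (intro allI impI)
  fix r :: nat
  assume "even r \<and> 2 * \<nu> \<le> r \<and> r \<le> 2 * \<nu> + 12 * (\<nu> div 3)"
  then obtain f where f: "graphical (4 ^ \<nu>) r f" using graphical_exists by blast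
  obtain n where n: "\<nu> = Suc n" using assms by (cases \<nu>) auto
  \<comment> \<open>A quarter of the order, \<open>2 ^ (2 * n)\<close>, is the common value
    \<open>2 ^ (2 * \<nu> - 2)\<close> of the last two parameters.\<close>
  have "4 * 2 ^ (2 * n) = (4 ^ \<nu> :: nat)" by (simp add: n power_mult)
  with f have "graphical (4 * 2 ^ (2 * n)) r f" by simp
  from graphical_srg[OF this] show "\<exists>G :: nat pair_pre_digraph.
      strongly_regular_graph G (2 ^ (2 * \<nu>) - 1) (2 ^ (2 * \<nu> - 1)) (2 ^ (2 * \<nu> - 2)) (2 ^ (2 * \<nu> - 2)) \<and>
      two_rank G = r"
    by (simp add: n)
qed

end
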